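(* Let $X=\{x\in\mathbb{R}^n : Ax=b,\ x\geq 0\}$ with $A\in\mathbb{Q}^{m\times n}$, $b\in\mathbb{Q}^m$, let $c_1,c_2,d_1\in\mathbb{Q}^n$ be (row) objective vectors, and let $j\in\{1,2\}$. The Breakpoint Enumeration Algorithm for $\mathrm{PBLP}^j$, applied to a minimal solution set $S$ of TOLP, finds all breakpoints: every breakpoint of $\mathrm{PBLP}^j$ belongs to the set $\mathcal{B}=\bigcup_{x\in S}\{\lambda_\ell(x),\lambda_u(x)\}$ of interval boundaries computed by the algorithm.
   Context: For a parameter value $\lambda$, $\mathrm{PBLP}^1(\lambda)$ is the biobjective linear program $\min_{x\in X}(c_1x+\lambda d_1x,\ c_2x)^\top$ and $\mathrm{PBLP}^2(\lambda)$ is $\min_{x\in X}(c_1x+\lambda d_1x,\ c_2x+\lambda d_1x)^\top$. TOLP is the triobjective linear program $\min_{x\in X}(c_1x,c_2x,d_1x)^\top$, with image set $Y=\{(c_1x,c_2x,d_1x)^\top:x\in X\}$. Solution sets: for a multi-objective linear program $\min_{x\in X}Cx$, an image $y^*\in\{Cx:x\in X\}$ is nondominated if no other image $y\ne y^*$ satisfies $y_i\le y^*_i$ for all $i$, and it is an extreme nondominated image if it is also an extreme point of the image set. A solution set is a set $S\subseteq X$ containing, for every extreme nondominated image $y$, some $x$ with $Cx=y$; it is minimal if no solution set has smaller cardinality. One writes $S(\mathrm{PBLP}^j(\lambda_1))\neq S(\mathrm{PBLP}^j(\lambda_2))$ if $\mathrm{PBLP}^j(\lambda_1)$ and $\mathrm{PBLP}^j(\lambda_2)$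 have no minimal solution set in common. A value $\lambda\ge 0$ is a breakpoint of $\mathrm{PBLP}^j$ if for all sufficiently small $\varepsilon>0$, $S(\mathrm{PBLP}^j(\lambda+\varepsilon))\ne S(\mathrm{PBLP}^j(\lambda-\varepsilon))$. Weights: $\mathcal{W}(\mathrm{TOLP})=\{w\in\mathbb{R}^3: w_i\ge 0,\ w_1+w_2+w_3=1\}$, and for $y\in Y$, $\mathcal{W}(y)=\{w\in\mathcal{W}(\mathrm{TOLP}): w^\top y=\min\{w^\top y':y'\in Y\}\}$. For $\lambda\ge 0$, $\mathcal{W}(\mathrm{PBLP}^1(\lambda))=\{w\in\mathcal{W}(\mathrm{TOLP}): w_1(1+\lambda)+w_2=1\}$ and $\mathcal{W}(\mathrm{PBLP}^2(\lambda))=\{w\in\mathcal{W}(\mathrm{TOLP}): w_1+w_2=\frac1{1+\lambda}\}$. Algorithm: for each $x\in S$, with image $y=(c_1x,c_2x,d_1x)^\top$, the algorithm computes (by solving two linear programs) the minimum $\lambda_\ell(x)$ and the maximum $\lambda_u(x)$ of $\lambda\ge 0$ subject to the existence of a weight $w\in\mathcal{W}(y)\cap\mathcal{W}(\mathrm{PBLP}^j(\lambda))$, where for $j=1$ the weight $w=(0,1,0)$ is excluded. If the maximization problem is unbounded or its supremum is approached only as $\lambda\to\infty$, then $\lambda_u(x)=\infty$. The algorithm outputs the intervals $[\lambda_\ell(x),\lambda_u(x)]$ for all $x\in S$ and the set $\mathcal{B}$ of all their boundaries.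
   Formalization: For the breakpoint λ = 0 it is additionally assumed that, if X is nonempty, TOLP has a nondominated image; otherwise S and B are empty while 0 can be a breakpoint (X = [0,∞), c1 = c2 = 0, d1 = −1). Positive breakpoints are covered without restriction. *)

theory Defs
  imports "HOL-Analysis.Analysis" "HOL-Library.Equipollence"
begin

text \<open>A multi-objective linear program is given by its feasible set \<open>X\<close> and the matrix \<open>C\<close> whose
  rows are the objectives.\<close>

definition feasible_set :: "real^'n^'m \<Rightarrow> real^'m \<Rightarrow> (real^'n) set" where
  "feasible_set A b = {x. A *v x = b \<and> (\<forall>i. 0 \<le> x $ i)}"

definition image_set :: "(real^'n) set \<Rightarrow> real^'n^'k \<Rightarrow> (real^'k) set" where
  "image_set X C = {C *v x | x. x \<in> X}"

definition nondominated :: "(real^'n) set \<Rightarrow> real^'n^'k \<Rightarrow> real^'k \<Rightarrow> bool" where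
  "nondominated X C y \<longleftrightarrow> y \<in> image_set X C \<and>
     \<not> (\<exists>y'\<in>image_set X C. y' \<noteq> y \<and> (\<forall>i. y' $ i \<le> y $ i))"

definition extreme_nondominated :: "(real^'n) set \<Rightarrow> real^'n^'k \<Rightarrow> real^'k \<Rightarrow> bool" where
  "extreme_nondominated X C y \<longleftrightarrow> nondominated X C y \<and> y extreme_point_of image_set X C"

definition solution_set :: "(real^'n) set \<Rightarrow> real^'n^'k \<Rightarrow> (real^'n) set \<Rightarrow> bool" where
  "solution_set X C S \<longleftrightarrow> S \<subseteq> X \<and> (\<forall>y. extreme_nondominated X C y \<longrightarrow> (\<exists>x\<in>S. C *v x = y))"

text \<open>Cardinalities are compared with \<open>\<prec>\<close>, because \<open>card\<close> is 0 on infinite sets.\<close>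

definition minimal_solution_set :: "(real^'n) set \<Rightarrow> real^'n^'k \<Rightarrow> (real^'n) set \<Rightarrow> bool" where
  "minimal_solution_set X C S \<longleftrightarrow> solution_set X C S \<and> \<not> (\<exists>T. solution_set X C T \<and> T \<prec> S)"

definition tolp :: "real^'n \<Rightarrow> real^'n \<Rightarrow> real^'n \<Rightarrow> real^'n^3" where
  "tolp c1 c2 d1 = vector [c1, c2, d1]"

text \<open>In the definitions below the index \<open>j\<close> is meant to be 1 or 2.\<close>

definition pblp :: "nat \<Rightarrow> real^'n \<Rightarrow> real^'n \<Rightarrow> real^'n \<Rightarrow> real \<Rightarrow> real^'n^2" where
  "pblp j c1 c2 d1 \<mu> =
     (if j = 1 then vector [c1 + \<mu> *\<^sub>R d1, c2]
      else vector [c1 + \<mu> *\<^sub>R d1, c2 + \<mu> *\<^sub>R d1])"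

text \<open>At \<open>\<mu> = 0\<close> this refers to the programs with the negative parameters \<open>- \<epsilon>\<close>. If the
  triobjective program is feasible but has no nondominated image, 0 can be a breakpoint although
  there are no interval boundaries at all: take \<open>X = [0, \<infinity>)\<close>, \<open>c1 = c2 = 0\<close>, \<open>d1 = -1\<close>.\<close>

definition breakpoint ::
  "nat \<Rightarrow> (real^'n) set \<Rightarrow> real^'n \<Rightarrow> real^'n \<Rightarrow> real^'n \<Rightarrow> real \<Rightarrow> bool" where
  "breakpoint j X c1 c2 d1 \<mu> \<longleftrightarrow> 0 \<le> \<mu> \<and>
     (\<forall>\<^sub>F \<epsilon> in at_right 0.
        \<not> (\<exists>S. minimal_solution_set X (pblp j c1 c2 d1 (\<mu> + \<epsilon>)) S \<and>
               minimal_solution_set X (pblp j c1 c2 d1 (\<mu> - \<epsilon>)) S))"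

definition weights_tolp :: "(real^3) set" where
  "weights_tolp = {w. (\<forall>i. 0 \<le> w $ i) \<and> w $ 1 + w $ 2 + w $ 3 = 1}"

definition weights_image :: "(real^3) set \<Rightarrow> real^3 \<Rightarrow> (real^3) set" where
  "weights_image Y y = {w \<in> weights_tolp. \<forall>y'\<in>Y. w \<bullet> y \<le> w \<bullet> y'}"

definition weights_pblp :: "nat \<Rightarrow> real \<Rightarrow> (real^3) set" where
  "weights_pblp j \<mu> =
     (if j = 1 then {w \<in> weights_tolp. w $ 1 * (1 + \<mu>) + w $ 2 = 1}
      else {w \<in> weights_tolp. w $ 1 + w $ 2 = 1 / (1 + \<mu>)})"

definition admissible_params ::
  "nat \<Rightarrow> (real^'n) set \<Rightarrow> real^'n \<Rightarrow> real^'n \<Rightarrow> real^'n \<Rightarrow> real^'n \<Rightarrow> real set" where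
  "admissible_params j X c1 c2 d1 x =
     {\<mu>. 0 \<le> \<mu> \<and>
        (\<exists>w \<in> weights_image (image_set X (tolp c1 c2 d1)) (tolp c1 c2 d1 *v x) \<inter> weights_pblp j \<mu>.
            j = 1 \<longrightarrow> w \<noteq> vector [0, 1, 0])}"

text \<open>For a preimage \<open>x\<close> of a nondominated image the admissible parameters form a nonempty closed
  interval, so the infimum is a minimum and the supremum is either a maximum or \<open>\<infinity>\<close>.\<close>

definition lambda_lower ::
  "nat \<Rightarrow> (real^'n) set \<Rightarrow> real^'n \<Rightarrow> real^'n \<Rightarrow> real^'n \<Rightarrow> real^'n \<Rightarrow> ereal" where
  "lambda_lower j X c1 c2 d1 x = (INF \<mu>\<in>admissible_params j X c1 c2 d1 x. ereal \<mu>)"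

definition lambda_upper ::
  "nat \<Rightarrow> (real^'n) set \<Rightarrow> real^'n \<Rightarrow> real^'n \<Rightarrow> real^'n \<Rightarrow> real^'n \<Rightarrow> ereal" where
  "lambda_upper j X c1 c2 d1 x = (SUP \<mu>\<in>admissible_params j X c1 c2 d1 x. ereal \<mu>)"

definition interval_boundaries ::
  "nat \<Rightarrow> (real^'n) set \<Rightarrow> real^'n \<Rightarrow> real^'n \<Rightarrow> real^'n \<Rightarrow> (real^'n) set \<Rightarrow> ereal set" where
  "interval_boundaries j X c1 c2 d1 S =
     (\<Union>x\<in>S. {lambda_lower j X c1 c2 d1 x, lambda_upper j X c1 c2 d1 x})"

end

theory Submission
  imports Defs
begin

text \<open>Weights \<open>w\<close> of the triobjective program whose third component is \<open>l\<close> times \<open>w $ 1\<close> (for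
  \<open>j = 1\<close>) or \<open>w $ 1 + w $ 2\<close> (for \<open>j = 2\<close>) are exactly the weights of the biobjective program with
  parameter \<open>l\<close>, so the parameters admissible for an image \<open>y\<close> are the slopes of the planes that meet
  its weight set. If the image polyhedron \<open>Y\<close> contains a line, then so does the biobjective image
  set for all parameters but one, hence it has no extreme points. Otherwise, if \<open>\<mu>\<close> is no interval boundary, then some ball around
  \<open>\<mu>\<close> is for every extreme nondominated \<open>y\<close> either inside or outside the interval of \<open>y\<close>. The weight
  set of \<open>y\<close> is full-dimensional, so for a parameter in the interior of the interval the plane
  contains a positive weight exposing \<open>y\<close>, and \<open>y\<close> projects to an extreme nondominated image from
  which it can be recovered. Conversely, every extreme nondominated image for a positive parameter
  arises in this way, since its fibre is a face of \<open>Y\<close>. Hence the same points form a minimal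
  solution set on both sides of \<open>\<mu>\<close>.\<close>

section \<open>Polyhedrality of linear images of the feasible set\<close>

text \<open>Linear maps send finitely generated cones to finitely generated cones, and these are
  polyhedra; generators of the orthant therefore make all its linear images polyhedral.\<close>

lemma nonneg_orthant_eq_cone_hull:
  "{x::real^'n. \<forall>i. 0 \<le> x $ i} = convex_cone hull (range (\<lambda>i. axis i 1))" (is "?L = ?R")
proof
  show "?L \<subseteq> ?R"
  proof
    fix x :: "real^'n" assume "x \<in> ?L"
    then have summand: "x $ i *\<^sub>R axis i 1 \<in> ?R" for i
      by (simp add: convex_cone_hull_mul hull_inc)
    have "(\<Sum>i\<in>I. x $ i *\<^sub>R axis i 1) \<in> ?R" if "finite I" for I
      using that
      by (induction I rule: finite_induct)
        (auto simp: convex_cone_hull_contains_0 intro: convex_cone_hull_add summand)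
    moreover have "x = (\<Sum>i\<in>UNIV. x $ i *\<^sub>R axis i 1)"
      using basis_expansion[of x] by (simp add: scalar_mult_eq_scaleR)
    ultimately show "x \<in> ?R" by (metis finite)
  qed
  show "?R \<subseteq> ?L"
    by (rule hull_minimal) (auto simp: convex_cone_iff axis_def)
qed

lemma polyhedron_affine_section:
  fixes S :: "('a::euclidean_space \<times> 'b::euclidean_space) set"
  assumes "polyhedron S"
  shows "polyhedron {y. (b, y) \<in> S}"
proof -
  obtain F where F: "finite F" "S = \<Inter>F" "\<forall>h\<in>F. \<exists>a c. a \<noteq> 0 \<and> h = {x. a \<bullet> x \<le> c}"
    using assms unfolding polyhedron_def by blast
  have "polyhedron {y. (b, y) \<in> h}" if h: "h \<in> F" for h
  proof -
    obtain a c where h_eq: "h = {x. a \<bullet> x \<le> c}"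
      using F(3) h by blast
    have "{y. (b, y) \<in> h} = {y. snd a \<bullet> y \<le> c - fst a \<bullet> b}"
      by (cases a) (auto simp: h_eq)
    then show ?thesis by (simp add: polyhedron_halfspace_le)
  qed
  moreover have "{y. (b, y) \<in> S} = \<Inter>((\<lambda>h. {y. (b, y) \<in> h}) ` F)"
    using F(2) by auto
  ultimately show ?thesis
    using F(1) by auto
qed

text \<open>The vectors \<open>(A *v x, f x)\<close> with \<open>x\<close> in the orthant form a
  finitely generated cone, and the image of the feasible set is its slice at first component
  \<open>b\<close>.\<close>

lemma polyhedron_linear_image_feasible_set:
  fixes A :: "real^'n^'m" and f :: "real^'n \<Rightarrow> 'b::euclidean_space"
  assumes "linear f"
  shows "polyhedron (f ` feasible_set A b)"
proof -
  let ?G = "(\<lambda>x. (A *v x, f x)) ` {x::real^'n. \<forall>i. 0 \<le> x $ i}"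
  have "linear (\<lambda>x. (A *v x, f x))"
    using assms by (intro linearI)
      (simp_all add: linear_add linear_scale matrix_vector_right_distrib matrix_vector_mult_scaleR)
  then have "polyhedron ?G"
    unfolding nonneg_orthant_eq_cone_hull convex_cone_hull_linear_image[symmetric]
    by (simp add: convex_cone_hull_linear_image[symmetric] polyhedron_convex_cone_hull)
  moreover have "f ` feasible_set A b = {y. (b, y) \<in> ?G}"
    unfolding feasible_set_def by auto
  ultimately show ?thesis
    by (simp add: polyhedron_affine_section)
qed

lemma image_set_eq_image: "image_set X C = (*v) C ` X"
  unfolding image_set_def by blast

lemma polyhedron_image_set: "polyhedron (image_set (feasible_set A b) C)"
  unfolding image_set_eq_image
  by (intro polyhedron_linear_image_feasible_set matrix_vector_mul_linear)

section \<open>Lines, extreme points and tangent cones of polyhedra\<close>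

text \<open>A linear functional bounded above on a line is constant along it, so every halfspace
  containing the line is invariant under translation along its direction.\<close>

lemma polyhedron_line_translate:
  fixes S :: "'a::euclidean_space set"
  assumes "polyhedron S" "\<And>t::real. p + t *\<^sub>R v \<in> S" "z \<in> S"
  shows "z + t *\<^sub>R v \<in> S"
proof -
  obtain F where F: "S = \<Inter>F" "\<forall>h\<in>F. \<exists>a c. a \<noteq> 0 \<and> h = {x. a \<bullet> x \<le> c}"
    using assms(1) unfolding polyhedron_def by blast
  have "z + t *\<^sub>R v \<in> h" if h: "h \<in> F" for h
  proof -
    obtain a c where h_eq: "h = {x. a \<bullet> x \<le> c}"
      using F(2) h by blast
    have le: "a \<bullet> p + s * (a \<bullet> v) \<le> c" for s
      using assms(2)[of s] h F(1) by (auto simp: h_eq inner_add_right)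
    have "a \<bullet> v = 0"
    proof (rule ccontr)
      assume "a \<bullet> v \<noteq> 0"
      \<comment> \<open>This multiple of \<open>v\<close> would give the functional the value
        \<open>c + 1\<close>.\<close>
      then show False
        using le[of "(c - a \<bullet> p + 1) / (a \<bullet> v)"] by simp
    qed
    moreover have "a \<bullet> z \<le> c" using assms(3) h F(1) by (auto simp: h_eq)
    ultimately show ?thesis by (simp add: h_eq inner_add_right)
  qed
  then show ?thesis using F(1) by blast
qed

text \<open>With \<open>z\<close> the set contains \<open>z + v\<close> and \<open>z - v\<close>,
  whose midpoint is \<open>z\<close>.\<close>

lemma no_extreme_point_if_line:
  fixes S :: "'a::euclidean_space set"
  assumes "polyhedron S" "\<And>t::real. p + t *\<^sub>R v \<in> S" "v \<noteq> 0"
  shows "\<not> z extreme_point_of S"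
proof
  assume z: "z extreme_point_of S"
  then have "z \<in> S" by (simp add: extreme_point_of_def)
  then have "z + t *\<^sub>R v \<in> S" for t
    by (rule polyhedron_line_translate[OF assms(1,2)])
  from this[of 1] this[of "-1"] have "z + v \<in> S" "z - v \<in> S" by auto
  moreover have "z \<in> open_segment (z + v) (z - v)"
  proof -
    have "z = midpoint (z + v) (z - v)"
      by (simp add: midpoint_def scaleR_2[symmetric])
    moreover have "z + v \<noteq> z - v"
    proof
      assume "z + v = z - v"
      then have "(2::real) *\<^sub>R v = 0" by (simp add: scaleR_2 eq_neg_iff_add_eq_0)
      then show False using assms(3) by simp
    qed
    ultimately show ?thesis
      using midpoint_in_open_segment by metis
  qed
  ultimately show False using z by (auto simp: extreme_point_of_def)
qed

text \<open>Induction on the dimension. A convex set with empty relative frontier is affine, so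
  without lines it is a point; otherwise there is a nonempty proper face of smaller dimension, and
  extreme points of a face are extreme in the whole set.\<close>

lemma polyhedron_extreme_point_exists:
  fixes S :: "'a::euclidean_space set"
  assumes "polyhedron S" "S \<noteq> {}"
    and "\<And>p v. v \<noteq> 0 \<Longrightarrow> \<exists>t::real. p + t *\<^sub>R v \<notin> S"
  shows "\<exists>z. z extreme_point_of S"
  using assms
proof (induction "nat (aff_dim S)" arbitrary: S rule: less_induct)
  case less
  have "convex S" using less.prems(1) by (rule polyhedron_imp_convex)
  show ?case
  proof (cases "rel_frontier S = {}")
    case True
    then have "affine S"
      by (simp add: rel_frontier_eq_empty)
    obtain p where p: "p \<in> S" using less.prems(2) by blast
    have "S = {p}"
    proof (rule ccontr)
      assume "S \<noteq> {p}"
      then obtain q where q: "q \<in> S" "q \<noteq> p" using p by blast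
      have "p + t *\<^sub>R (q - p) \<in> S" for t
        using mem_affine[OF \<open>affine S\<close> p q(1), of "1 - t" t] by (simp add: algebra_simps)
      then show False using less.prems(3)[of "q - p" p] q(2) by auto
    qed
    then show ?thesis by auto
  next
    case False
    then obtain F where F: "F face_of S" "F \<noteq> {}" "F \<noteq> S"
      unfolding rel_frontier_of_polyhedron_alt[OF less.prems(1)] by blast
    have "aff_dim F < aff_dim S"
      using F \<open>convex S\<close> by (intro face_of_aff_dim_lt) auto
    \<comment> \<open>\<open>nat\<close> sends the dimension -1 of the empty set to 0, so the strict
      decrease needs a nonnegative dimension.\<close>
    moreover have "0 \<le> aff_dim F" using F(2) aff_dim_negative_iff[of F] by linarith
    ultimately have "nat (aff_dim F) < nat (aff_dim S)" by linarith
    moreover have "polyhedron F"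
      using face_of_polyhedron_polyhedron less.prems(1) F(1) by blast
    moreover have "\<exists>t::real. p + t *\<^sub>R v \<notin> F" if "v \<noteq> 0" for p v
      using less.prems(3)[OF that] face_of_imp_subset[OF F(1)] by blast
    ultimately obtain z where "z extreme_point_of F"
      using less.hyps F(2) by blast
    then show ?thesis using F(1) extreme_point_of_face by blast
  qed
qed

text \<open>\<open>K\<close> is cut out by the constraints active at \<open>z\<close>; the others
  have slack at \<open>z\<close> and survive a small step in any direction.\<close>

lemma polyhedron_tangent_cone:
  fixes S :: "'a::euclidean_space set"
  assumes "polyhedron S" "z \<in> S"
  obtains K where "closed K" "convex_cone K" "\<And>y. y \<in> S \<Longrightarrow> y - z \<in> K"
    "\<And>d. d \<in> K \<Longrightarrow> \<exists>\<epsilon>>0. z + \<epsilon> *\<^sub>R d \<in> S"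
proof -
  obtain F where F: "finite F" "S = \<Inter>F" "\<forall>h\<in>F. \<exists>a c. a \<noteq> 0 \<and> h = {x. a \<bullet> x \<le> c}"
    using assms(1) unfolding polyhedron_def by blast
  then obtain a c where ac: "\<And>h. h \<in> F \<Longrightarrow> h = {x. a h \<bullet> x \<le> c h}"
    by metis
  have z: "a h \<bullet> z \<le> c h" if "h \<in> F" for h
    using assms(2) F(2) ac[OF that] that by blast
  define K where "K = (\<Inter>h\<in>{h\<in>F. a h \<bullet> z = c h}. {d. a h \<bullet> d \<le> 0})"
  show thesis
  proof
    show "closed K"
      unfolding K_def by (intro closed_INT ballI closed_halfspace_le)
    show "convex_cone K"
      unfolding K_def by (rule convex_cone_Inter) (auto simp: convex_cone_halfspace_le)
    show "y - z \<in> K" if "y \<in> S" for y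
      using that F(2) ac by (fastforce simp: K_def inner_diff_right)
    show "\<exists>\<epsilon>>0. z + \<epsilon> *\<^sub>R d \<in> S" if d: "d \<in> K" for d
    proof -
      have "\<forall>\<^sub>F \<epsilon> in at_right (0::real). z + \<epsilon> *\<^sub>R d \<in> h" if h: "h \<in> F" for h
      proof (cases "a h \<bullet> z = c h")
        case True
        then have "a h \<bullet> d \<le> 0" using d h by (auto simp: K_def)
        then have "z + \<epsilon> *\<^sub>R d \<in> h" if "\<epsilon> > 0" for \<epsilon>
          using that True by (subst ac[OF h]) (auto simp: inner_add_right mult_le_0_iff)
        then show ?thesis
          by (auto intro: eventually_mono[OF eventually_at_right_less])
      next
        case False
        then have less: "a h \<bullet> z < c h" using z[OF h] by simp
        have "((\<lambda>\<epsilon>::real. a h \<bullet> (z + \<epsilon> *\<^sub>R d)) \<longlongrightarrow> a h \<bullet> (z + 0 *\<^sub>R d)) (at_right 0)"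
          by (intro tendsto_intros)
        then have "\<forall>\<^sub>F \<epsilon> in at_right (0::real). a h \<bullet> (z + \<epsilon> *\<^sub>R d) < c h"
          using less by (intro order_tendstoD(2)) auto
        then show ?thesis
          by eventually_elim (subst ac[OF h], simp)
      qed
      then have "\<forall>\<^sub>F \<epsilon> in at_right (0::real). \<forall>h\<in>F. z + \<epsilon> *\<^sub>R d \<in> h"
        using F(1) by (simp add: eventually_ball_finite)
      then have "\<forall>\<^sub>F \<epsilon> in at_right (0::real). 0 < \<epsilon> \<and> z + \<epsilon> *\<^sub>R d \<in> S"
        using eventually_at_right_less[of "0::real"] by eventually_elim (simp add: F(2))
      then show ?thesis
        using eventually_happens[of _ "at_right (0::real)"] by force
    qed
  qed
qed

section \<open>Positive weights supporting or exposing nondominated images\<close>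

text \<open>Nondominance keeps all nonzero nonpositive directions out of the tangent cone at
  \<open>z\<close>, so a hyperplane separates the cone from them.\<close>

lemma nondominated_positive_weight:
  fixes C :: "real^'n^'k"
  assumes "polyhedron (image_set X C)" "nondominated X C z"
  obtains u where "\<And>i. 0 < u $ i" "\<And>y. y \<in> image_set X C \<Longrightarrow> u \<bullet> z \<le> u \<bullet> y"
proof -
  have z: "z \<in> image_set X C" using assms(2) by (simp add: nondominated_def)
  obtain K where K: "closed K" "convex_cone K" "\<And>y. y \<in> image_set X C \<Longrightarrow> y - z \<in> K"
    "\<And>d. d \<in> K \<Longrightarrow> \<exists>\<epsilon>>0. z + \<epsilon> *\<^sub>R d \<in> image_set X C"
    using polyhedron_tangent_cone[OF assms(1) z] by blast
  \<comment> \<open>A compact base of the nonpositive orthant: leaving out the origin makes strict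
    separation from the closed cone \<open>K\<close> possible, and strictness yields positive
    components.\<close>
  let ?T = "convex hull (range (\<lambda>i. - axis i 1 :: real^'k))"
  have T: "(\<forall>i. d $ i \<le> 0) \<and> (\<Sum>i\<in>UNIV. d $ i) = -1" if "d \<in> ?T" for d
  proof -
    have "?T \<subseteq> {d. (\<forall>i. d $ i \<le> 0) \<and> (\<Sum>i\<in>UNIV. d $ i) = -1}"
    proof (rule hull_minimal)
      show "convex {d::real^'k. (\<forall>i. d $ i \<le> 0) \<and> (\<Sum>i\<in>UNIV. d $ i) = -1}"
      proof (rule convexI)
        fix x y :: "real^'k" and a b :: real
        assume x: "x \<in> {d. (\<forall>i. d $ i \<le> 0) \<and> (\<Sum>i\<in>UNIV. d $ i) = -1}"
          and y: "y \<in> {d. (\<forall>i. d $ i \<le> 0) \<and> (\<Sum>i\<in>UNIV. d $ i) = -1}"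
          and ab: "0 \<le> a" "0 \<le> b" "a + b = 1"
        have "a * x $ i + b * y $ i \<le> 0" for i
          using x y ab by (auto intro!: add_nonpos_nonpos mult_nonneg_nonpos)
        moreover have "(\<Sum>i\<in>UNIV. a * x $ i + b * y $ i) = -1"
          using x y ab by (simp add: sum.distrib sum_distrib_left[symmetric])
        ultimately show "a *\<^sub>R x + b *\<^sub>R y \<in> {d. (\<forall>i. d $ i \<le> 0) \<and> (\<Sum>i\<in>UNIV. d $ i) = -1}"
          by simp
      qed
    qed (auto simp: axis_def sum_negf)
    then show ?thesis using that by blast
  qed
  have "K \<inter> ?T = {}"
  proof (rule ccontr)
    assume "K \<inter> ?T \<noteq> {}"
    then obtain d where d: "d \<in> K" "d \<in> ?T" by blast
    obtain \<epsilon> where e: "\<epsilon> > 0" "z + \<epsilon> *\<^sub>R d \<in> image_set X C" using K(4) d(1) by blast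
    have "d \<noteq> 0" using T[OF d(2)] by auto
    moreover have "\<forall>i. (z + \<epsilon> *\<^sub>R d) $ i \<le> z $ i"
      using T[OF d(2)] e(1) by (simp add: mult_nonneg_nonpos)
    ultimately show False
      using assms(2) e unfolding nondominated_def by (metis add_cancel_left_right less_irrefl scaleR_eq_0_iff)
  qed
  then obtain u \<beta> where u: "\<forall>x\<in>?T. u \<bullet> x < \<beta>" "\<forall>x\<in>K. \<beta> < u \<bullet> x"
    using separating_hyperplane_compact_closed[of ?T K] K(1,2)
    by (auto simp: convex_cone_def finite_imp_compact_convex_hull Int_commute)
  have b: "\<beta> < 0" using u(2) convex_cone_contains_0[OF K(2)] by force
  show thesis
  proof
    show "0 < u $ i" for i
    proof -
      have "- axis i 1 \<in> ?T" by (auto intro: hull_inc)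
      then have "u \<bullet> (- axis i 1) < \<beta>" using u(1) by blast
      then show ?thesis using b by (simp add: inner_axis)
    qed
    show "u \<bullet> z \<le> u \<bullet> y" if "y \<in> image_set X C" for y
    proof (rule ccontr)
      assume "\<not> u \<bullet> z \<le> u \<bullet> y"
      then have neg: "u \<bullet> (y - z) < 0" by (simp add: inner_diff_right)
      \<comment> \<open>This positive multiple of \<open>y - z\<close> stays in the cone and has
        exactly the value \<open>\<beta>\<close> under \<open>u\<close>.\<close>
      have "(\<beta> / (u \<bullet> (y - z))) *\<^sub>R (y - z) \<in> K"
        using neg b by (intro convex_cone_scaleR K(2,3) that) (simp add: divide_nonpos_neg)
      then have "\<beta> < u \<bullet> ((\<beta> / (u \<bullet> (y - z))) *\<^sub>R (y - z))" using u(2) by blast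
      then show False using neg by simp
    qed
  qed
qed

lemma nondominated_if_positive_weight:
  fixes C :: "real^'n^'k"
  assumes "y \<in> image_set X C" "\<And>i. 0 < w $ i" "\<And>y'. y' \<in> image_set X C \<Longrightarrow> w \<bullet> y \<le> w \<bullet> y'"
  shows "nondominated X C y"
  unfolding nondominated_def
proof (intro conjI notI assms(1))
  assume "\<exists>y'\<in>image_set X C. y' \<noteq> y \<and> (\<forall>i. y' $ i \<le> y $ i)"
  then obtain y' where y': "y' \<in> image_set X C" "y' \<noteq> y" "\<And>i. y' $ i \<le> y $ i" by blast
  then obtain k where "y' $ k < y $ k" by (metis vec_eq_iff order_less_le)
  then have "w \<bullet> y' < w \<bullet> y"
    unfolding inner_vec_def using assms(2) y'(3)
    by (intro sum_strict_mono_ex1) (auto intro!: bexI[of _ k] mult_left_mono less_imp_le)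
  then show False using assms(3)[OF y'(1)] by simp
qed

text \<open>Extreme points of a polyhedron are exposed, but the exposing functional \<open>h\<close>
  may have components of any sign. Subtracting a small multiple of it from a positive supporting
  weight keeps positivity and makes the minimiser unique.\<close>

lemma extreme_nondominated_exposing_weight:
  fixes C :: "real^'n^'k"
  assumes poly: "polyhedron (image_set X C)" and y: "extreme_nondominated X C y"
  obtains w where "\<And>i. 0 < w $ i"
    "\<And>y'. \<lbrakk>y' \<in> image_set X C; y' \<noteq> y\<rbrakk> \<Longrightarrow> w \<bullet> y < w \<bullet> y'"
proof -
  let ?Y = "image_set X C"
  obtain u where u: "\<And>i. 0 < u $ i" "\<And>y'. y' \<in> ?Y \<Longrightarrow> u \<bullet> y \<le> u \<bullet> y'"
    using nondominated_positive_weight[OF poly] y unfolding extreme_nondominated_def by blast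
  have "{y} exposed_face_of ?Y"
    using y unfolding exposed_face_of_polyhedron[OF poly] extreme_nondominated_def
    by (simp add: face_of_singleton)
  then obtain h \<beta> where h: "?Y \<subseteq> {x. h \<bullet> x \<le> \<beta>}" "{y} = ?Y \<inter> {x. h \<bullet> x = \<beta>}"
    unfolding exposed_face_of_def by auto
  have h_less: "h \<bullet> y' < h \<bullet> y" if "y' \<in> ?Y" "y' \<noteq> y" for y'
  proof -
    have "h \<bullet> y = \<beta>" using h(2) by blast
    moreover have "h \<bullet> y' \<noteq> \<beta>" using h(2) that by blast
    moreover have "h \<bullet> y' \<le> \<beta>" using h(1) that by blast
    ultimately show ?thesis by linarith
  qed
  have "\<forall>\<^sub>F \<epsilon> in at_right (0::real). 0 < u $ i - \<epsilon> * h $ i" for i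
  proof -
    have "((\<lambda>\<epsilon>::real. u $ i - \<epsilon> * h $ i) \<longlongrightarrow> u $ i - 0 * h $ i) (at_right 0)"
      by (intro tendsto_intros)
    then show ?thesis using u(1)[of i] by (intro order_tendstoD(1)) auto
  qed
  then have "\<forall>\<^sub>F \<epsilon> in at_right (0::real). \<forall>i\<in>UNIV. 0 < u $ i - \<epsilon> * h $ i"
    by (intro eventually_ball_finite) auto
  then have "\<forall>\<^sub>F \<epsilon> in at_right (0::real). 0 < \<epsilon> \<and> (\<forall>i. 0 < u $ i - \<epsilon> * h $ i)"
    using eventually_at_right_less[of "0::real"] by eventually_elim auto
  then obtain \<epsilon> :: real where e: "0 < \<epsilon>" "\<And>i. 0 < u $ i - \<epsilon> * h $ i"
    using eventually_happens[of _ "at_right (0::real)"] by force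
  show thesis
  proof
    show "0 < (u - \<epsilon> *\<^sub>R h) $ i" for i using e(2) by simp
    show "(u - \<epsilon> *\<^sub>R h) \<bullet> y < (u - \<epsilon> *\<^sub>R h) \<bullet> y'" if "y' \<in> ?Y" "y' \<noteq> y" for y'
      using u(2)[OF that(1)] mult_strict_left_mono[OF h_less[OF that] e(1)]
      by (simp add: inner_diff_left)
  qed
qed

text \<open>A bounded linear program attains its minimum because the set of its values is a polyhedron,
  hence closed. The optimal face then contains an extreme point.\<close>

lemma extreme_nondominated_minimizer_exists:
  fixes A :: "real^'n^'m" and b :: "real^'m" and C :: "real^'n^'k"
  defines "Y \<equiv> image_set (feasible_set A b) C"
  assumes "Y \<noteq> {}" and w: "\<And>i. 0 < w $ i" and bnd: "\<And>y. y \<in> Y \<Longrightarrow> \<beta> \<le> w \<bullet> y"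
    and no_line: "\<And>p v. v \<noteq> 0 \<Longrightarrow> \<exists>t::real. p + t *\<^sub>R v \<notin> Y"
  obtains y where "extreme_nondominated (feasible_set A b) C y"
    "\<And>y'. y' \<in> Y \<Longrightarrow> w \<bullet> y \<le> w \<bullet> y'"
proof -
  have poly: "polyhedron Y" unfolding Y_def by (rule polyhedron_image_set)
  have "linear (\<lambda>x. w \<bullet> (C *v x))"
    by (intro linearI) (simp_all add: matrix_vector_right_distrib inner_add_right
        matrix_vector_mult_scaleR)
  then have "polyhedron ((\<lambda>x. w \<bullet> (C *v x)) ` feasible_set A b)"
    by (rule polyhedron_linear_image_feasible_set)
  then have "closed ((\<bullet>) w ` Y)"
    unfolding Y_def image_set_eq_image image_image by (rule polyhedron_imp_closed)
  moreover have bb: "bdd_below ((\<bullet>) w ` Y)" using bnd by (intro bdd_belowI2)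
  ultimately have "Inf ((\<bullet>) w ` Y) \<in> (\<bullet>) w ` Y"
    using \<open>Y \<noteq> {}\<close> by (intro closed_contains_Inf) auto
  then obtain y0 where y0: "y0 \<in> Y" "w \<bullet> y0 = Inf ((\<bullet>) w ` Y)" by auto
  have min0: "w \<bullet> y0 \<le> w \<bullet> y'" if "y' \<in> Y" for y'
    unfolding y0(2) using bb that by (intro cInf_lower) auto
  define F where "F = Y \<inter> {y. w \<bullet> y = w \<bullet> y0}"
  have face: "F face_of Y" unfolding F_def
    using min0 poly by (intro face_of_Int_supporting_hyperplane_ge) (auto intro: polyhedron_imp_convex)
  have "\<exists>y. y extreme_point_of F"
  proof (rule polyhedron_extreme_point_exists)
    show "polyhedron F" using face poly face_of_polyhedron_polyhedron by blast
    show "F \<noteq> {}" using y0(1) by (auto simp: F_def)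
    show "\<exists>t::real. p + t *\<^sub>R v \<notin> F" if "v \<noteq> 0" for p v
      using no_line[OF that, of p] by (auto simp: F_def)
  qed
  then obtain y where y: "y extreme_point_of F" by blast
  then have yF: "y \<in> F" by (simp add: extreme_point_of_def)
  have min: "w \<bullet> y \<le> w \<bullet> y'" if "y' \<in> Y" for y'
    using yF min0[OF that] by (auto simp: F_def)
  show thesis
  proof (rule that)
    show "extreme_nondominated (feasible_set A b) C y"
      unfolding extreme_nondominated_def Y_def[symmetric]
    proof
      show "nondominated (feasible_set A b) C y"
        using yF min w by (intro nondominated_if_positive_weight[of _ _ _ w]) (auto simp: F_def Y_def)
      show "y extreme_point_of Y" using y face extreme_point_of_face by blast
    qed
  qed (rule min)
qed

section \<open>Recognising minimal solution sets\<close>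

text \<open>Every solution set \<open>T\<close> contains, for each point of \<open>S\<close>, a
  point with the same image; choosing one is injective because points of \<open>S\<close> have
  distinct images. Hence \<open>T\<close> is not strictly smaller than \<open>S\<close>.\<close>

lemma minimal_solution_setI:
  assumes "S \<subseteq> X" "inj_on ((*v) C) S" "\<And>y. extreme_nondominated X C y \<longleftrightarrow> y \<in> (*v) C ` S"
  shows "minimal_solution_set X C S"
proof -
  have "S \<lesssim> T" if T: "solution_set X C T" for T
  proof -
    have "\<forall>x\<in>S. \<exists>t\<in>T. C *v t = C *v x"
      using T assms(3) unfolding solution_set_def by blast
    then obtain f where f: "\<And>x. x \<in> S \<Longrightarrow> f x \<in> T \<and> C *v f x = C *v x" by metis
    then have "inj_on f S" using assms(2) by (metis inj_on_def)
    then show ?thesis using f unfolding lepoll_def by blast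
  qed
  then show ?thesis
    using assms unfolding minimal_solution_set_def solution_set_def
    by (metis (mono_tags, lifting) imageE lesspoll_def lepoll_antisym)
qed

section \<open>Projection to two objectives and lifting of weights\<close>

text \<open>\<open>lift_weight j l\<close> is the adjoint of \<open>proj_image j l\<close>.\<close>

definition proj_image :: "nat \<Rightarrow> real \<Rightarrow> real^3 \<Rightarrow> real^2" where
  "proj_image j l y = vector [y $ 1 + l * y $ 3, if j = 1 then y $ 2 else y $ 2 + l * y $ 3]"

definition base_weight :: "nat \<Rightarrow> real^3 \<Rightarrow> real" where
  "base_weight j w = (if j = 1 then w $ 1 else w $ 1 + w $ 2)"

definition lift_weight :: "nat \<Rightarrow> real \<Rightarrow> real^2 \<Rightarrow> real^3" where
  "lift_weight j l u = vector [u $ 1, u $ 2, l * (if j = 1 then u $ 1 else u $ 1 + u $ 2)]"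

lemma linear_proj_image: "linear (proj_image j l)"
  by (rule linearI) (auto simp: proj_image_def vec_eq_iff forall_2 algebra_simps)

lemma linear_base_weight: "linear (base_weight j)"
  by (rule linearI) (auto simp: base_weight_def algebra_simps)

lemma pblp_mult_eq_proj_image:
  "pblp j c1 c2 d1 l *v x = proj_image j l (tolp c1 c2 d1 *v x)"
  by (auto simp: pblp_def tolp_def proj_image_def vec_eq_iff forall_2 matrix_vector_mul_component
      inner_add_left)

lemma image_set_pblp:
  "image_set X (pblp j c1 c2 d1 l) = proj_image j l ` image_set X (tolp c1 c2 d1)"
  unfolding image_set_eq_image image_image pblp_mult_eq_proj_image ..

lemma lift_weight_inner: "lift_weight j l u \<bullet> y = u \<bullet> proj_image j l y"
  by (simp add: lift_weight_def proj_image_def inner_vec_def sum_2 sum_3 algebra_simps)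

lemma lift_weight_components [simp]:
  "lift_weight j l u $ 1 = u $ 1" "lift_weight j l u $ 2 = u $ 2"
  "lift_weight j l u $ 3 = l * base_weight j (lift_weight j l u)"
  by (simp_all add: lift_weight_def base_weight_def)

lemma lift_weight_eq:
  assumes "w $ 3 = l * base_weight j w"
  shows "lift_weight j l (vector [w $ 1, w $ 2]) = w"
  using assms by (simp add: vec_eq_iff forall_3 lift_weight_def base_weight_def)

lemma base_weight_pos:
  assumes "0 < w $ 1" "0 < w $ 2"
  shows "0 < base_weight j w"
  using assms by (simp add: base_weight_def)

section \<open>Parameters of the supporting weights of an image\<close>

text \<open>An unnormalised form of the admissible parameters: without the condition that components
  sum to 1, positive combinations of weights are available. For \<open>j = 1\<close>, positivity of
  \<open>base_weight\<close> replaces the exclusion of \<open>(0, 1, 0)\<close>.\<close>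

definition weight_params :: "nat \<Rightarrow> (real^3) set \<Rightarrow> real^3 \<Rightarrow> real set" where
  "weight_params j Y y = {l. 0 \<le> l \<and> (\<exists>w. (\<forall>i. 0 \<le> w $ i) \<and> 0 < base_weight j w \<and>
     w $ 3 = l * base_weight j w \<and> (\<forall>y'\<in>Y. w \<bullet> y \<le> w \<bullet> y'))}"

lemma weight_paramsI:
  assumes "0 \<le> l" "\<And>i. 0 \<le> w $ i" "0 < base_weight j w" "w $ 3 = l * base_weight j w"
    "\<And>y'. y' \<in> Y \<Longrightarrow> w \<bullet> y \<le> w \<bullet> y'"
  shows "l \<in> weight_params j Y y"
  unfolding weight_params_def using assms by blast

text \<open>For \<open>j = 1\<close> and \<open>w $ 1 = 0\<close> the constraints force \<open>w = (0, 1, 0)\<close>, which is the excluded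
  weight.\<close>

lemma admissible_params_eq_weight_params:
  assumes "j \<in> {1, 2}"
  shows "admissible_params j X c1 c2 d1 x
    = weight_params j (image_set X (tolp c1 c2 d1)) (tolp c1 c2 d1 *v x)"
    (is "_ = weight_params j ?Y ?y")
proof (intro set_eqI iffI)
  fix l assume "l \<in> admissible_params j X c1 c2 d1 x"
  then obtain w where l: "0 \<le> l" and w: "w \<in> weights_image ?Y ?y" "w \<in> weights_pblp j l"
    and excl: "j = 1 \<longrightarrow> w \<noteq> vector [0, 1, 0]"
    unfolding admissible_params_def by blast
  have nn: "\<And>i. 0 \<le> w $ i" and sum1: "w $ 1 + w $ 2 + w $ 3 = 1"
    and min: "\<forall>y'\<in>?Y. w \<bullet> ?y \<le> w \<bullet> y'"
    using w(1) by (auto simp: weights_image_def weights_tolp_def)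
  have "0 < base_weight j w \<and> w $ 3 = l * base_weight j w"
  proof (cases "j = 1")
    case True
    then have "w $ 1 * (1 + l) + w $ 2 = 1" using w(2) by (simp add: weights_pblp_def)
    then have w3: "w $ 3 = l * w $ 1" using sum1 by (simp add: algebra_simps)
    have "w $ 1 \<noteq> 0"
    proof
      assume "w $ 1 = 0"
      then have "w = vector [0, 1, 0]" using w3 sum1 by (simp add: vec_eq_iff forall_3)
      then show False using excl True by simp
    qed
    then show ?thesis using w3 nn[of 1] True by (simp add: base_weight_def)
  next
    case False
    then have "w $ 1 + w $ 2 = 1 / (1 + l)" using w(2) by (simp add: weights_pblp_def)
    moreover from this have "w $ 3 = 1 - 1 / (1 + l)" using sum1 by simp
    moreover have "0 < 1 / (1 + l)" "1 - 1 / (1 + l) = l * (1 / (1 + l))"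
      using l by (auto simp: field_simps)
    ultimately show ?thesis using False by (simp add: base_weight_def)
  qed
  then show "l \<in> weight_params j ?Y ?y"
    using l nn min by (blast intro: weight_paramsI)
next
  fix l assume "l \<in> weight_params j ?Y ?y"
  then obtain w where l: "0 \<le> l" and nn: "\<And>i. 0 \<le> w $ i" and pos: "0 < base_weight j w"
    and w3: "w $ 3 = l * base_weight j w" and min: "\<forall>y'\<in>?Y. w \<bullet> ?y \<le> w \<bullet> y'"
    unfolding weight_params_def by blast
  \<comment> \<open>The conditions on \<open>w\<close> are homogeneous, so dividing by the component
    sum gives a normalised weight.\<close>
  define s where "s = w $ 1 + w $ 2 + w $ 3"
  have s: "0 < s"
    using pos nn[of 1] nn[of 2] nn[of 3] by (auto simp: s_def base_weight_def split: if_splits)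
  define v where "v = (1 / s) *\<^sub>R w"
  have v_simp: "v $ i = w $ i / s" for i by (simp add: v_def)
  have tol: "v \<in> weights_tolp"
    unfolding weights_tolp_def using s nn
    by (auto simp: v_simp add_divide_distrib[symmetric] s_def[symmetric])
  moreover have "v \<bullet> ?y \<le> v \<bullet> y'" if "y' \<in> ?Y" for y'
    using min that s by (simp add: v_def divide_right_mono)
  ultimately have "v \<in> weights_image ?Y ?y" by (simp add: weights_image_def)
  moreover have "v \<in> weights_pblp j l"
  proof (cases "j = 1")
    case True
    then have "w $ 1 * (1 + l) + w $ 2 = s"
      using w3 by (simp add: s_def base_weight_def algebra_simps)
    then have "v $ 1 * (1 + l) + v $ 2 = 1"
      using s by (simp add: v_simp add_divide_distrib[symmetric])
    then show ?thesis using True tol by (simp add: weights_pblp_def)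
  next
    case False
    then have "(w $ 1 + w $ 2) * (1 + l) = s"
      using w3 by (simp add: s_def base_weight_def algebra_simps)
    then have "(v $ 1 + v $ 2) * (1 + l) = 1"
      using s by (simp add: v_simp add_divide_distrib[symmetric])
    then have "v $ 1 + v $ 2 = 1 / (1 + l)" using l by (simp add: field_simps)
    then show ?thesis using False tol by (simp add: weights_pblp_def)
  qed
  moreover have "j = 1 \<longrightarrow> v \<noteq> vector [0, 1, 0]"
  proof (intro impI notI)
    assume j: "j = 1" and v0: "v = vector [0, 1, 0]"
    have "v $ 1 = 0" by (simp add: v0)
    then show False using pos s j by (simp add: v_simp base_weight_def)
  qed
  ultimately show "l \<in> admissible_params j X c1 c2 d1 x"
    unfolding admissible_params_def using l by blast
qed

text \<open>The weight \<open>a *\<^sub>R v + c *\<^sub>R w\<close> lies on the plane of parameter \<open>l\<close> because its coefficients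
  balance the signed defects of \<open>v\<close> and \<open>w\<close>.\<close>

lemma weight_between:
  fixes v w :: "real^3"
  assumes "v $ 3 < l * base_weight j v" "l * base_weight j w < w $ 3"
  obtains a c where "0 < a" "0 < c"
    "(a *\<^sub>R v + c *\<^sub>R w) $ 3 = l * base_weight j (a *\<^sub>R v + c *\<^sub>R w)"
proof
  show "0 < w $ 3 - l * base_weight j w" "0 < l * base_weight j v - v $ 3" using assms by auto
  show "((w $ 3 - l * base_weight j w) *\<^sub>R v + (l * base_weight j v - v $ 3) *\<^sub>R w) $ 3 =
    l * base_weight j ((w $ 3 - l * base_weight j w) *\<^sub>R v + (l * base_weight j v - v $ 3) *\<^sub>R w)"
    unfolding linear_add[OF linear_base_weight] linear_scale[OF linear_base_weight]
    by (simp add: algebra_simps)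
qed

text \<open>The weights of \<open>a\<close> and \<open>b\<close> lie on opposite sides of the plane
  of parameter \<open>l\<close>, so a positive combination lies on it and still supports
  \<open>y\<close>.\<close>

lemma weight_params_convex:
  assumes "a \<in> weight_params j Y y" "b \<in> weight_params j Y y" "a < l" "l < b"
  shows "l \<in> weight_params j Y y"
proof -
  obtain v where v: "0 \<le> a" "\<forall>i. 0 \<le> v $ i" "0 < base_weight j v" "v $ 3 = a * base_weight j v"
    "\<forall>y'\<in>Y. v \<bullet> y \<le> v \<bullet> y'"
    using assms(1) unfolding weight_params_def by blast
  obtain w where w: "\<forall>i. 0 \<le> w $ i" "0 < base_weight j w" "w $ 3 = b * base_weight j w"
    "\<forall>y'\<in>Y. w \<bullet> y \<le> w \<bullet> y'"
    using assms(2) unfolding weight_params_def by blast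
  obtain r s where rs: "0 < r" "0 < s"
    "(r *\<^sub>R v + s *\<^sub>R w) $ 3 = l * base_weight j (r *\<^sub>R v + s *\<^sub>R w)"
    using weight_between[of v l j w] v w assms(3,4) by auto
  have "\<forall>i. 0 \<le> (r *\<^sub>R v + s *\<^sub>R w) $ i" using rs v w by simp
  moreover have "0 < base_weight j (r *\<^sub>R v + s *\<^sub>R w)"
    using rs v w
    by (simp add: linear_add[OF linear_base_weight] linear_scale[OF linear_base_weight] add_pos_pos)
  moreover have "\<forall>y'\<in>Y. (r *\<^sub>R v + s *\<^sub>R w) \<bullet> y \<le> (r *\<^sub>R v + s *\<^sub>R w) \<bullet> y'"
    using rs(1,2) v w by (auto simp: inner_add_left intro!: add_mono mult_left_mono)
  ultimately show ?thesis
    using rs(3) v(1) assms(3) by (intro weight_paramsI[of l "r *\<^sub>R v + s *\<^sub>R w"]) auto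
qed

text \<open>Such an \<open>m\<close> is below the infimum, above the supremum, or strictly between
  two points of \<open>I\<close>; in the last case convexity puts a ball into \<open>I\<close>. An
  empty \<open>I\<close> has infimum \<infinity> and supremum -\<infinity>, so the first two cases
  cover it.\<close>

lemma nonboundary_ball:
  fixes I :: "real set"
  assumes conv: "\<And>a b l. \<lbrakk>a \<in> I; b \<in> I; a < l; l < b\<rbrakk> \<Longrightarrow> l \<in> I"
    and "ereal m \<noteq> (INF l\<in>I. ereal l)" "ereal m \<noteq> (SUP l\<in>I. ereal l)"
  obtains d where "0 < d" "ball m d \<subseteq> I \<or> ball m d \<inter> I = {}"
proof -
  consider "ereal m < (INF l\<in>I. ereal l)" | "(SUP l\<in>I. ereal l) < ereal m"
    | "(INF l\<in>I. ereal l) < ereal m" "ereal m < (SUP l\<in>I. ereal l)"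
    using assms(2,3) by (meson linorder_less_linear)
  then show thesis
  proof cases
    case 1
    then obtain r where r: "ereal m < ereal r" "ereal r < (INF l\<in>I. ereal l)"
      using ereal_dense2 by blast
    have "r < l" if "l \<in> I" for l using less_INF_D[OF r(2) that] by simp
    then have "ball m (r - m) \<inter> I = {}" by (force simp: dist_real_def)
    then show thesis using r(1) by (intro that[of "r - m"]) auto
  next
    case 2
    then obtain r where r: "ereal r < ereal m" "(SUP l\<in>I. ereal l) < ereal r"
      using ereal_dense2 by blast
    have "l < r" if "l \<in> I" for l using SUP_lessD[OF r(2) that] by simp
    then have "ball m (m - r) \<inter> I = {}" by (force simp: dist_real_def)
    then show thesis using r(1) by (intro that[of "m - r"]) auto
  next
    case 3
    then obtain a b where ab: "a \<in> I" "a < m" "b \<in> I" "m < b"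
      by (auto simp: INF_less_iff less_SUP_iff)
    have "ball m (min (m - a) (b - m)) \<subseteq> I"
      using conv[OF ab(1,3)] by (auto simp: dist_real_def)
    then show thesis using ab by (intro that[of "min (m - a) (b - m)"]) auto
  qed
qed

section \<open>Correspondence of extreme nondominated images in three and two objectives\<close>

text \<open>Some positive weight on the plane of parameter \<open>l\<close> exposes
  \<open>y\<close>. It is the lift of a positive biobjective weight, which by adjointness is minimal
  only at the projection of \<open>y\<close>, with \<open>y\<close> as the sole preimage.\<close>

lemma extreme_nondominated_projection:
  assumes poly: "polyhedron (image_set X (tolp c1 c2 d1))"
    and y: "extreme_nondominated X (tolp c1 c2 d1) y"
    and a: "a \<in> weight_params j (image_set X (tolp c1 c2 d1)) y"
    and b: "b \<in> weight_params j (image_set X (tolp c1 c2 d1)) y"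
    and l: "a < l" "l < b"
  shows "extreme_nondominated X (pblp j c1 c2 d1 l) (proj_image j l y)"
    and "\<And>y'. \<lbrakk>y' \<in> image_set X (tolp c1 c2 d1); proj_image j l y' = proj_image j l y\<rbrakk> \<Longrightarrow> y' = y"
proof -
  let ?Y = "image_set X (tolp c1 c2 d1)"
  have yY: "y \<in> ?Y" using y by (simp add: extreme_nondominated_def nondominated_def)
  obtain w where w: "\<And>i. 0 < w $ i" "\<And>y'. \<lbrakk>y' \<in> ?Y; y' \<noteq> y\<rbrakk> \<Longrightarrow> w \<bullet> y < w \<bullet> y'"
    using extreme_nondominated_exposing_weight[OF poly y] by blast
  obtain wa where wa: "\<forall>i. 0 \<le> wa $ i" "0 < base_weight j wa" "wa $ 3 = a * base_weight j wa"
    "\<forall>y'\<in>?Y. wa \<bullet> y \<le> wa \<bullet> y'"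
    using a unfolding weight_params_def by blast
  obtain wb where wb: "\<forall>i. 0 \<le> wb $ i" "0 < base_weight j wb" "wb $ 3 = b * base_weight j wb"
    "\<forall>y'\<in>?Y. wb \<bullet> y \<le> wb \<bullet> y'"
    using b unfolding weight_params_def by blast
  text \<open>A small multiple of the exposing weight is added to the weight of parameter \<open>a\<close>, so that
    the balanced combination with the weight of parameter \<open>b\<close> is still exposing.\<close>
  define D where "D = \<bar>w $ 3 - l * base_weight j w\<bar> + 1"
  define e where "e = (l * base_weight j wa - wa $ 3) / D"
  have D: "0 < D" "w $ 3 - l * base_weight j w < D" by (auto simp: D_def)
  have "0 < l * base_weight j wa - wa $ 3" using wa l by simp
  then have e: "0 < e" using D by (simp add: e_def)
  have "e * (w $ 3 - l * base_weight j w) < e * D"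
    using e D by (intro mult_strict_left_mono) auto
  also have "\<dots> = l * base_weight j wa - wa $ 3" using D by (simp add: e_def)
  finally have "e * (w $ 3 - l * base_weight j w) < l * base_weight j wa - wa $ 3" .
  then have "(wa + e *\<^sub>R w) $ 3 < l * base_weight j (wa + e *\<^sub>R w)"
    by (simp add: linear_add[OF linear_base_weight] linear_scale[OF linear_base_weight]
        algebra_simps)
  moreover have "l * base_weight j wb < wb $ 3" using wb l by simp
  ultimately obtain r s where rs: "0 < r" "0 < s" "(r *\<^sub>R (wa + e *\<^sub>R w) + s *\<^sub>R wb) $ 3
      = l * base_weight j (r *\<^sub>R (wa + e *\<^sub>R w) + s *\<^sub>R wb)"
    using weight_between by blast
  define q where "q = r *\<^sub>R (wa + e *\<^sub>R w) + s *\<^sub>R wb"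
  have q_pos: "0 < q $ i" for i
    unfolding q_def using rs(1,2) e wa(1) wb(1) w(1)[of i]
    by (simp add: add_nonneg_pos add_pos_nonneg)
  have q_less: "q \<bullet> y < q \<bullet> y'" if "y' \<in> ?Y" "y' \<noteq> y" for y'
  proof -
    have "wa \<bullet> y + e * (w \<bullet> y) < wa \<bullet> y' + e * (w \<bullet> y')"
      using wa(4) w(2)[OF that] that(1) e by (intro add_le_less_mono mult_strict_left_mono) auto
    then show ?thesis
      unfolding q_def using rs(1,2) wb(4) that(1)
      by (auto simp: inner_add_left intro!: add_less_le_mono mult_left_mono mult_strict_left_mono)
  qed
  define u :: "real^2" where "u = vector [q $ 1, q $ 2]"
  have "q \<bullet> y' = u \<bullet> proj_image j l y'" for y'
    unfolding u_def lift_weight_inner[symmetric] using lift_weight_eq rs(3) q_def by metis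
  then have u_less: "u \<bullet> proj_image j l y < u \<bullet> proj_image j l y'" if "y' \<in> ?Y" "y' \<noteq> y" for y'
    using q_less[OF that] by simp
  have u_pos: "0 < u $ i" for i
    using q_pos exhaust_2[of i] by (auto simp: u_def)
  show inj: "y' = y" if "y' \<in> ?Y" "proj_image j l y' = proj_image j l y" for y'
    using u_less[OF that(1)] that(2) by force
  let ?Z = "image_set X (pblp j c1 c2 d1 l)"
  have zZ: "proj_image j l y \<in> ?Z" unfolding image_set_pblp using yY by blast
  have z_less: "u \<bullet> proj_image j l y < u \<bullet> z" if "z \<in> ?Z" "z \<noteq> proj_image j l y" for z
    using that u_less unfolding image_set_pblp by auto
  show "extreme_nondominated X (pblp j c1 c2 d1 l) (proj_image j l y)"
    unfolding extreme_nondominated_def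
  proof
    have "u \<bullet> proj_image j l y \<le> u \<bullet> z" if "z \<in> ?Z" for z
      using z_less[OF that] by (cases "z = proj_image j l y") auto
    then show "nondominated X (pblp j c1 c2 d1 l) (proj_image j l y)"
      using zZ u_pos by (intro nondominated_if_positive_weight[of _ _ _ u]) auto
    show "proj_image j l y extreme_point_of ?Z"
      unfolding extreme_point_of_def
    proof (intro conjI ballI notI zZ)
      fix p q assume pq: "p \<in> ?Z" "q \<in> ?Z" and seg: "proj_image j l y \<in> open_segment p q"
      then have "p \<noteq> proj_image j l y" "q \<noteq> proj_image j l y"
        by (auto simp: open_segment_def)
      then have less: "u \<bullet> proj_image j l y < u \<bullet> p" "u \<bullet> proj_image j l y < u \<bullet> q"
        using z_less pq by auto
      obtain t where t: "0 < t" "t < 1" "proj_image j l y = (1 - t) *\<^sub>R p + t *\<^sub>R q"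
        using seg by (auto simp: in_segment)
      have "u \<bullet> proj_image j l y = (1 - t) * (u \<bullet> p) + t * (u \<bullet> q)"
        by (simp add: t(3) inner_add_right)
      also have "\<dots> > (1 - t) * (u \<bullet> proj_image j l y) + t * (u \<bullet> proj_image j l y)"
        using t less by (intro add_strict_mono mult_strict_left_mono) auto
      finally show False by (simp add: algebra_simps)
    qed
  qed
qed

text \<open>The fibre over \<open>z\<close> contains no line and so has an extreme point
  \<open>y\<close>, which is extreme in the whole image set because the fibre is a face. A positive
  weight supporting \<open>z\<close> lifts to one supporting \<open>y\<close>.\<close>

lemma extreme_nondominated_lift:
  assumes poly: "polyhedron (image_set X (tolp c1 c2 d1))"
    and no_line: "\<And>p v. v \<noteq> 0 \<Longrightarrow> \<exists>t::real. p + t *\<^sub>R v \<notin> image_set X (tolp c1 c2 d1)"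
    and polyZ: "polyhedron (image_set X (pblp j c1 c2 d1 l))"
    and z: "extreme_nondominated X (pblp j c1 c2 d1 l) z"
    and l: "0 < l"
  obtains y where "extreme_nondominated X (tolp c1 c2 d1) y" "proj_image j l y = z"
    "l \<in> weight_params j (image_set X (tolp c1 c2 d1)) y"
proof -
  let ?Y = "image_set X (tolp c1 c2 d1)" and ?Z = "image_set X (pblp j c1 c2 d1 l)"
  have zZ: "z \<in> ?Z" and z_ext: "z extreme_point_of ?Z" and z_nd: "nondominated X (pblp j c1 c2 d1 l) z"
    using z by (auto simp: extreme_nondominated_def nondominated_def)
  obtain u where u: "\<And>i. 0 < u $ i" "\<And>z'. z' \<in> ?Z \<Longrightarrow> u \<bullet> z \<le> u \<bullet> z'"
    using nondominated_positive_weight[OF polyZ z_nd] by blast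
  define F where "F = ?Y \<inter> {y. proj_image j l y = z}"
  have "{y. proj_image j l y = z} =
    {y. vector [1, 0, l] \<bullet> y = z $ 1} \<inter> {y. vector [0, 1, if j = 1 then 0 else l] \<bullet> y = z $ 2}"
    by (auto simp: proj_image_def vec_eq_iff forall_2 inner_vec_def sum_3)
  then have "polyhedron F"
    unfolding F_def using poly by (simp add: polyhedron_hyperplane)
  moreover have "F \<noteq> {}" using zZ unfolding F_def image_set_pblp by blast
  moreover have "\<exists>t::real. p + t *\<^sub>R v \<notin> F" if "v \<noteq> 0" for p v
    using no_line[OF that, of p] by (auto simp: F_def)
  ultimately have "\<exists>y. y extreme_point_of F"
    by (rule polyhedron_extreme_point_exists)
  then obtain y where y: "y extreme_point_of F" ..
  then have yF: "y \<in> ?Y" "proj_image j l y = z" by (auto simp: extreme_point_of_def F_def)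
  have "y extreme_point_of ?Y"
    unfolding extreme_point_of_def
  proof (intro conjI ballI notI yF(1))
    fix p q assume pq: "p \<in> ?Y" "q \<in> ?Y" and seg: "y \<in> open_segment p q"
    obtain t where t: "0 < t" "t < 1" "y = (1 - t) *\<^sub>R p + t *\<^sub>R q"
      using seg by (auto simp: in_segment)
    have z_eq: "z = (1 - t) *\<^sub>R proj_image j l p + t *\<^sub>R proj_image j l q"
      unfolding yF(2)[symmetric] t(3)
      by (simp add: linear_add[OF linear_proj_image] linear_scale[OF linear_proj_image])
    \<comment> \<open>Distinct projections would put \<open>z\<close> inside a segment of
      \<open>?Z\<close>. So a segment around \<open>y\<close> stays in the fibre, where
      \<open>y\<close> is extreme.\<close>
    have "proj_image j l p = proj_image j l q"
    proof (rule ccontr)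
      assume "proj_image j l p \<noteq> proj_image j l q"
      then have "z \<in> open_segment (proj_image j l p) (proj_image j l q)"
        using z_eq t(1,2) by (auto simp: in_segment)
      then show False
        using z_ext pq unfolding extreme_point_of_def image_set_pblp by blast
    qed
    then have "proj_image j l p = z" "proj_image j l q = z"
      using z_eq by (simp_all add: algebra_simps)
    then show False using y pq seg by (auto simp: extreme_point_of_def F_def)
  qed
  moreover
  define w where "w = lift_weight j l u"
  have w12: "0 < w $ 1" "0 < w $ 2" using u(1) by (auto simp: w_def)
  have base: "0 < base_weight j w" using base_weight_pos[OF w12] .
  have w3: "w $ 3 = l * base_weight j w" by (simp add: w_def)
  \<comment> \<open>Here positivity of \<open>l\<close> makes the third component of the lifted
    weight positive.\<close>
  then have "0 < w $ 3" using base l by simp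
  then have w_pos: "0 < w $ i" for i using w12 exhaust_3[of i] by auto
  have min: "w \<bullet> y \<le> w \<bullet> y'" if "y' \<in> ?Y" for y'
    using u(2) that unfolding w_def lift_weight_inner yF(2) image_set_pblp by blast
  have "nondominated X (tolp c1 c2 d1) y"
    using nondominated_if_positive_weight[OF yF(1) w_pos min] .
  ultimately have "extreme_nondominated X (tolp c1 c2 d1) y"
    by (simp add: extreme_nondominated_def)
  moreover have "l \<in> weight_params j ?Y y"
    using l base w3 min less_imp_le[OF w_pos] by (intro weight_paramsI[of l w]) auto
  ultimately show thesis using yF(2) that by blast
qed

lemma no_extreme_nondominated_if_line:
  assumes "polyhedron (image_set X (pblp j c1 c2 d1 l))"
    and "\<And>t::real. p + t *\<^sub>R v \<in> image_set X (tolp c1 c2 d1)" and "proj_image j l v \<noteq> 0"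
  shows "\<not> extreme_nondominated X (pblp j c1 c2 d1 l) z"
proof -
  have "proj_image j l p + t *\<^sub>R proj_image j l v \<in> image_set X (pblp j c1 c2 d1 l)" for t
  proof -
    have "proj_image j l p + t *\<^sub>R proj_image j l v = proj_image j l (p + t *\<^sub>R v)"
      by (simp add: linear_add[OF linear_proj_image] linear_scale[OF linear_proj_image])
    then show ?thesis unfolding image_set_pblp using assms(2) by auto
  qed
  then show ?thesis
    using no_extreme_point_if_line[OF assms(1) _ assms(3)] by (auto simp: extreme_nondominated_def)
qed

text \<open>Subtracting the first components leaves \<open>(l - l') * v $ 3 = 0\<close>, so for
  distinct parameters all of \<open>v\<close> vanishes. A line in the image set thus collapses to a
  point for at most one parameter.\<close>

lemma proj_image_eq_0_unique:
  assumes "v \<noteq> 0" "proj_image j l v = 0" "proj_image j l' v = 0"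
  shows "l = l'"
proof (rule ccontr)
  assume neq: "l \<noteq> l'"
  have eqs: "v $ 1 + l * v $ 3 = 0" "v $ 1 + l' * v $ 3 = 0" "v $ 3 = 0 \<Longrightarrow> v $ 2 = 0"
    using assms(2,3) by (auto simp: proj_image_def vec_eq_iff forall_2 split: if_splits)
  then have "(l - l') * v $ 3 = 0" unfolding left_diff_distrib by linarith
  then have "v = 0" using neq eqs by (auto simp: vec_eq_iff forall_3)
  then show False using assms(1) by simp
qed

lemma minimal_solution_set_empty:
  assumes "\<And>y. \<not> extreme_nondominated X C y"
  shows "minimal_solution_set X C {}"
  using assms by (intro minimal_solution_setI) auto

text \<open>A positive weight supporting the program with a negative parameter can be moved along a
  segment to a positive weight of the triobjective program; on the way every small positive
  parameter is met.\<close>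

lemma small_params_if_negative_param:
  fixes A :: "real^'n^'m" and b :: "real^'m"
  defines "X \<equiv> feasible_set A b"
  assumes no_line: "\<And>p v. v \<noteq> 0 \<Longrightarrow> \<exists>t::real. p + t *\<^sub>R v \<notin> image_set X (tolp c1 c2 d1)"
    and nd: "nondominated X (tolp c1 c2 d1) y1"
    and z: "nondominated X (pblp j c1 c2 d1 l) z" and l: "l < 0" and d: "0 < d"
  obtains y k where "extreme_nondominated X (tolp c1 c2 d1) y" "0 < k" "k < d"
    "k \<in> weight_params j (image_set X (tolp c1 c2 d1)) y"
proof -
  let ?Y = "image_set X (tolp c1 c2 d1)" and ?Z = "image_set X (pblp j c1 c2 d1 l)"
  obtain w where w: "\<And>i. 0 < w $ i" "\<And>y'. y' \<in> ?Y \<Longrightarrow> w \<bullet> y1 \<le> w \<bullet> y'"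
    using nondominated_positive_weight[OF _ nd] polyhedron_image_set X_def by blast
  obtain u where u: "\<And>i. 0 < u $ i" "\<And>z'. z' \<in> ?Z \<Longrightarrow> u \<bullet> z \<le> u \<bullet> z'"
    using nondominated_positive_weight[OF _ z] polyhedron_image_set X_def by blast
  define v where "v = lift_weight j l u"
  have v12: "0 < v $ 1" "0 < v $ 2" using u(1) by (auto simp: v_def)
  have base: "0 < base_weight j v" "0 < base_weight j w"
    using base_weight_pos v12 w(1) by auto
  have v3: "v $ 3 = l * base_weight j v" by (simp add: v_def)
  have v_min: "u \<bullet> z \<le> v \<bullet> y'" if "y' \<in> ?Y" for y'
    using u(2) that unfolding v_def lift_weight_inner image_set_pblp by blast
  \<comment> \<open>Smaller than the parameter \<open>w $ 3 / base_weight j w\<close> of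
    \<open>w\<close>, so that \<open>w\<close> lies above the plane of \<open>k\<close>;
    \<open>v\<close> lies below it, its third component being negative.\<close>
  define k where "k = min d (w $ 3 / base_weight j w) / 2"
  have k: "0 < k" "k < d" "k < w $ 3 / base_weight j w"
    using d base w(1)[of 3] by (auto simp: k_def min_def field_simps)
  have "v $ 3 < k * base_weight j v" using v3 base l k by simp
  moreover have "k * base_weight j w < w $ 3" using k(3) base by (simp add: field_simps)
  ultimately obtain r s where rs: "0 < r" "0 < s"
    "(r *\<^sub>R v + s *\<^sub>R w) $ 3 = k * base_weight j (r *\<^sub>R v + s *\<^sub>R w)"
    using weight_between by blast
  define q where "q = r *\<^sub>R v + s *\<^sub>R w"
  have q12: "0 < q $ 1" "0 < q $ 2"
    using v12 w(1) rs(1,2) by (auto simp: q_def intro!: add_pos_pos)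
  have q_base: "0 < base_weight j q" using base_weight_pos[OF q12] .
  have q3: "q $ 3 = k * base_weight j q" using rs(3) by (simp add: q_def)
  then have "0 < q $ 3" using q_base k by simp
  then have q_pos: "0 < q $ i" for i using q12 exhaust_3[of i] by auto
  \<comment> \<open>The values of \<open>v\<close> are bounded below by \<open>u \<bullet> z\<close>
    and those of \<open>w\<close> by \<open>w \<bullet> y1\<close>; the resulting bound for
    \<open>q\<close> lets its minimum be attained at an extreme nondominated image.\<close>
  have q_bnd: "r * (u \<bullet> z) + s * (w \<bullet> y1) \<le> q \<bullet> y'" if "y' \<in> ?Y" for y'
    using v_min[OF that] w(2)[OF that] rs(1,2)
    by (auto simp: q_def inner_add_left intro!: add_mono mult_left_mono)
  have "?Y \<noteq> {}" using nd by (auto simp: nondominated_def)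
  then obtain y where y: "extreme_nondominated X (tolp c1 c2 d1) y"
    "\<And>y'. y' \<in> ?Y \<Longrightarrow> q \<bullet> y \<le> q \<bullet> y'"
    using extreme_nondominated_minimizer_exists[of A b "tolp c1 c2 d1" q] q_pos q_bnd no_line
    unfolding X_def by metis
  moreover have "k \<in> weight_params j ?Y y"
    using k(1) q_base q3 y(2) less_imp_le[OF q_pos] by (intro weight_paramsI[of k q]) auto
  ultimately show thesis using k that by blast
qed

section \<open>A common minimal solution set on both sides of a parameter that is no interval
  boundary\<close>

theorem theorem28:
  fixes A :: "real^'n^'m" and b :: "real^'m" and c1 c2 d1 :: "real^'n"
    and X S :: "(real^'n) set" and j :: nat and \<mu> :: real
  assumes "\<forall>i k. A $ i $ k \<in> \<rat>" and "\<forall>i. b $ i \<in> \<rat>"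
    and "\<forall>k. c1 $ k \<in> \<rat>" and "\<forall>k. c2 $ k \<in> \<rat>" and "\<forall>k. d1 $ k \<in> \<rat>"
    and "X = feasible_set A b"
    and "j \<in> {1, 2}"
    and "minimal_solution_set X (tolp c1 c2 d1) S"
    and "breakpoint j X c1 c2 d1 \<mu>"
    and "\<mu> = 0 \<and> X \<noteq> {} \<longrightarrow> (\<exists>y. nondominated X (tolp c1 c2 d1) y)"
  shows "ereal \<mu> \<in> interval_boundaries j X c1 c2 d1 S"
proof (rule ccontr)
  assume not_boundary: "ereal \<mu> \<notin> interval_boundaries j X c1 c2 d1 S"
  define C where "C = tolp c1 c2 d1"
  define P where "P = pblp j c1 c2 d1"
  define Y where "Y = image_set X C"
  have polyY: "polyhedron Y" and polyZ: "\<And>l. polyhedron (image_set X (P l))"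
    unfolding Y_def \<open>X = feasible_set A b\<close> by (rule polyhedron_image_set)+
  have "0 \<le> \<mu>" using \<open>breakpoint j X c1 c2 d1 \<mu>\<close> by (simp add: breakpoint_def)
  have "\<forall>\<^sub>F \<epsilon> in at_right 0. \<exists>T. minimal_solution_set X (P (\<mu> + \<epsilon>)) T \<and>
      minimal_solution_set X (P (\<mu> - \<epsilon>)) T"
  proof (cases "\<exists>p v. v \<noteq> 0 \<and> (\<forall>t::real. p + t *\<^sub>R v \<in> Y)")
    case True
    then obtain p v where v: "v \<noteq> 0" "\<And>t::real. p + t *\<^sub>R v \<in> Y" by blast
    \<comment> \<open>The one parameter, if any, at which the direction \<open>v\<close>
      collapses.\<close>
    obtain l0 where l0: "\<And>l. l \<noteq> l0 \<Longrightarrow> proj_image j l v \<noteq> 0"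
      using proj_image_eq_0_unique[OF v(1)] by metis
    have "minimal_solution_set X (P l) {}" if "l \<noteq> l0" for l
      using no_extreme_nondominated_if_line[OF polyZ[unfolded P_def] v(2)[unfolded Y_def C_def] l0[OF that]]
      by (intro minimal_solution_set_empty) (simp add: P_def)
    \<comment> \<open>For positive \<open>\<epsilon>\<close> below \<open>r\<close>, both
      \<open>\<mu> + \<epsilon>\<close> and \<open>\<mu> - \<epsilon>\<close> avoid
      \<open>l0\<close>; if \<open>l0 = \<mu>\<close>, any radius works, hence the default
      1.\<close>
    moreover define r where "r = (if l0 = \<mu> then 1 else \<bar>l0 - \<mu>\<bar>)"
    ultimately have "minimal_solution_set X (P (\<mu> + \<epsilon>)) {} \<and> minimal_solution_set X (P (\<mu> - \<epsilon>)) {}"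
      if "0 < \<epsilon>" "\<epsilon> < r" for \<epsilon>
      using that by (auto split: if_splits)
    moreover have "0 < r" by (simp add: r_def)
    ultimately show ?thesis unfolding eventually_at_right_field by blast
  next
    case False
    then have no_line: "\<And>p v. v \<noteq> 0 \<Longrightarrow> \<exists>t::real. p + t *\<^sub>R v \<notin> Y" by blast
    define E0 where "E0 = {y. extreme_nondominated X C y}"
    have "E0 \<subseteq> {y. y extreme_point_of Y}"
      by (auto simp: E0_def extreme_nondominated_def Y_def)
    then have fin: "finite E0"
      using finite_polyhedron_extreme_points[OF polyY] by (rule finite_subset)
    have "\<exists>d>0. ball \<mu> d \<subseteq> weight_params j Y y \<or> ball \<mu> d \<inter> weight_params j Y y = {}"
      if y: "y \<in> E0" for y
    proof -
      obtain x where x: "x \<in> S" "C *v x = y"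
        using y \<open>minimal_solution_set X (tolp c1 c2 d1) S\<close>
        unfolding E0_def minimal_solution_set_def solution_set_def C_def by blast
      have "ereal \<mu> \<noteq> lambda_lower j X c1 c2 d1 x" "ereal \<mu> \<noteq> lambda_upper j X c1 c2 d1 x"
        using not_boundary x(1) unfolding interval_boundaries_def by auto
      then have "ereal \<mu> \<noteq> (INF l\<in>weight_params j Y y. ereal l)"
        "ereal \<mu> \<noteq> (SUP l\<in>weight_params j Y y. ereal l)"
        unfolding lambda_lower_def lambda_upper_def
          admissible_params_eq_weight_params[OF \<open>j \<in> {1, 2}\<close>]
        using x(2) by (auto simp: Y_def C_def)
      then show ?thesis
        using nonboundary_ball[of "weight_params j Y y" \<mu>] weight_params_convex by metis
    qed
    then obtain d where d: "\<And>y. y \<in> E0 \<Longrightarrow> 0 < d y"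
      "\<And>y. y \<in> E0 \<Longrightarrow>
        ball \<mu> (d y) \<subseteq> weight_params j Y y \<or> ball \<mu> (d y) \<inter> weight_params j Y y = {}"
      by metis
    \<comment> \<open>For nonzero \<open>\<mu>\<close> the bound \<open>\<mu>\<close> keeps the ball
      inside the positive parameters; for \<open>\<mu> = 0\<close> it is replaced by 1, so that
      \<open>\<delta>\<close> is positive.\<close>
    define \<delta> where "\<delta> = Min (insert (if \<mu> = 0 then 1 else \<mu>) (d ` E0))"
    have "0 < \<delta>" unfolding \<delta>_def using fin d(1) \<open>0 \<le> \<mu>\<close> by simp
    have \<delta>_le_mu: "\<mu> \<noteq> 0 \<Longrightarrow> \<delta> \<le> \<mu>" unfolding \<delta>_def using fin by simp
    have \<delta>_le_d: "\<delta> \<le> d y" if "y \<in> E0" for y unfolding \<delta>_def using fin that by simp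
    \<comment> \<open>By the choice of \<open>\<delta>\<close>, the ball is disjoint from the
      parameters of every image in \<open>E0\<close> outside \<open>E\<close>.\<close>
    define E where "E = {y \<in> E0. ball \<mu> \<delta> \<subseteq> weight_params j Y y}"
    have mem_E: "y \<in> E" if "y \<in> E0" "l \<in> weight_params j Y y" "l \<in> ball \<mu> \<delta>" for y l
    proof -
      have "ball \<mu> \<delta> \<subseteq> ball \<mu> (d y)" using \<delta>_le_d[OF that(1)] by (rule subset_ball)
      then show ?thesis unfolding E_def using d(2)[OF that(1)] that by blast
    qed
    have fwd: "extreme_nondominated X (P l) (proj_image j l y)"
      "\<And>y'. y' \<in> Y \<Longrightarrow> proj_image j l y' = proj_image j l y \<Longrightarrow> y' = y"
      if "l \<in> ball \<mu> \<delta>" "y \<in> E" for l y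
    proof -
      \<comment> \<open>The midpoints between \<open>l\<close> and the two ends of the ball are
        parameters of \<open>y\<close> on both sides of \<open>l\<close>.\<close>
      have ab: "(l + \<mu> - \<delta>) / 2 \<in> ball \<mu> \<delta>" "(l + \<mu> + \<delta>) / 2 \<in> ball \<mu> \<delta>"
        and less: "(l + \<mu> - \<delta>) / 2 < l" "l < (l + \<mu> + \<delta>) / 2"
        using that(1) by (auto simp: dist_real_def abs_less_iff field_simps)
      have "y \<in> E0" "ball \<mu> \<delta> \<subseteq> weight_params j Y y" using that(2) by (auto simp: E_def)
      note * = extreme_nondominated_projection[OF polyY[unfolded Y_def C_def]
          \<open>y \<in> E0\<close>[unfolded E0_def C_def mem_Collect_eq]
          subsetD[OF this(2) ab(1), unfolded Y_def C_def]
          subsetD[OF this(2) ab(2), unfolded Y_def C_def] less]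
      show "extreme_nondominated X (P l) (proj_image j l y)"
        unfolding P_def by (rule *(1))
      show "y' = y" if "y' \<in> Y" "proj_image j l y' = proj_image j l y" for y'
        using *(2) that unfolding Y_def C_def by blast
    qed
    have bwd: "z \<in> proj_image j l ` E"
      if l: "l \<in> ball \<mu> \<delta>" "l \<noteq> \<mu>" and z: "extreme_nondominated X (P l) z" for l z
    proof (cases "0 < l")
      case True
      obtain y where "extreme_nondominated X C y" "proj_image j l y = z" "l \<in> weight_params j Y y"
        using extreme_nondominated_lift[OF polyY[unfolded Y_def C_def] no_line[unfolded Y_def C_def]
            polyZ[unfolded P_def] z[unfolded P_def] True]
        unfolding Y_def C_def by blast
      then show ?thesis using mem_E l(1) by (auto simp: E0_def)
    next
      case False
      \<comment> \<open>A nonpositive \<open>l\<close> occurs only in a ball around 0. As no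
        parameter set contains the negative number \<open>l\<close>, \<open>E\<close> is then empty,
        and producing a member of it gives the contradiction.\<close>
      have "\<mu> = 0"
        using False \<delta>_le_mu l(1) by (cases "\<mu> = 0") (auto simp: dist_real_def)
      then have "l < 0" using False l(2) by simp
      have nd: "nondominated X (P l) z" using z by (simp add: extreme_nondominated_def)
      then have "X \<noteq> {}" by (auto simp: nondominated_def image_set_def)
      then obtain y1 where "nondominated X (tolp c1 c2 d1) y1"
        using \<open>\<mu> = 0\<close> assms(10) by blast
      then obtain y k where y: "extreme_nondominated X C y" "0 < k" "k < \<delta>"
        "k \<in> weight_params j Y y"
        using small_params_if_negative_param[of A b c1 c2 d1 y1 j l z \<delta>] no_line nd \<open>l < 0\<close> \<open>0 < \<delta>\<close>
        unfolding Y_def C_def P_def \<open>X = feasible_set A b\<close> by blast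
      have "k \<in> ball \<mu> \<delta>" using y(2,3) \<open>\<mu> = 0\<close> by simp
      then have "y \<in> E" using mem_E y(1,4) by (simp add: E0_def)
      moreover have "l \<notin> weight_params j Y y" using \<open>l < 0\<close> by (simp add: weight_params_def)
      ultimately show ?thesis using l(1) by (auto simp: E_def)
    qed
    have EY: "E \<subseteq> (*v) C ` X"
      by (auto simp: E_def E0_def extreme_nondominated_def nondominated_def image_set_eq_image)
    \<comment> \<open>One preimage is chosen for each image in \<open>E\<close>, independently of
      \<open>l\<close>, so the same \<open>T\<close> serves both sides of
      \<open>\<mu>\<close>.\<close>
    then obtain T where T: "T \<subseteq> X" "inj_on ((*v) C) T" "E = (*v) C ` T"
      unfolding subset_image_inj by blast
    have T_min: "minimal_solution_set X (P l) T" if l: "l \<in> ball \<mu> \<delta>" "l \<noteq> \<mu>" for l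
    proof (rule minimal_solution_setI)
      have P_mult: "P l *v x = proj_image j l (C *v x)" for x
        unfolding P_def C_def by (rule pblp_mult_eq_proj_image)
      have "inj_on (proj_image j l) E"
        using fwd(2)[OF l(1)] EY unfolding inj_on_def Y_def image_set_eq_image by blast
      then have "inj_on (proj_image j l \<circ> (*v) C) T"
        using T(2,3) by (simp add: comp_inj_on)
      then show "inj_on ((*v) (P l)) T" by (simp add: inj_on_def P_mult)
      have "(*v) (P l) ` T = proj_image j l ` E"
        unfolding T(3) image_image P_mult ..
      then show "extreme_nondominated X (P l) z \<longleftrightarrow> z \<in> (*v) (P l) ` T" for z
        using fwd(1)[OF l(1)] bwd[OF l] by auto
    qed (rule T(1))
    have "minimal_solution_set X (P (\<mu> + \<epsilon>)) T \<and> minimal_solution_set X (P (\<mu> - \<epsilon>)) T"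
      if "0 < \<epsilon>" "\<epsilon> < \<delta>" for \<epsilon>
      using that by (intro conjI T_min) (auto simp: dist_real_def)
    then show ?thesis
      unfolding eventually_at_right_field using \<open>0 < \<delta>\<close> by blast
  qed
  moreover have "\<forall>\<^sub>F \<epsilon> in at_right 0. \<not> (\<exists>T. minimal_solution_set X (P (\<mu> + \<epsilon>)) T \<and>
      minimal_solution_set X (P (\<mu> - \<epsilon>)) T)"
    using \<open>breakpoint j X c1 c2 d1 \<mu>\<close> by (simp add: breakpoint_def P_def)
  ultimately have "\<forall>\<^sub>F \<epsilon> in at_right (0::real). False" by eventually_elim blast
  then show False by simp
qed

end
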